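(* Let $p\ge 2$ be an integer, let $D\subset\mathbb{Z}^2$ be a finite digit set with $\emptyset\neq\mathcal{Z}_D^2\subset\mathring{E}_p^2$, and let $M\in M_2(\mathbb{Z})$ be an expanding integer matrix with $\gcd(\det(M),p)=1$. Then $$n^*(\mu_{M,D})\le\widetilde{P}\ \text{ if } M\in\mathfrak{M}_p^{(1)},\qquad n^*(\mu_{M,D})=p^2\ \text{ if } M\in\mathfrak{M}_p^{(2)}.$$
   Context: A real square matrix is expanding if all its eigenvalues have modulus $>1$. For an expanding matrix $M\in M_2(\mathbb{R})$ and a finite set $D\subset\mathbb{R}^2$ with cardinality $\#(D)$, put $\phi_d(x)=M^{-1}(x+d)$ for $x\in\mathbb{R}^2$, $d\in D$. The self-affine measure $\mu_{M,D}$ is the unique Borel probability measure $\mu$ on $\mathbb{R}^2$ satisfying $\mu=\frac{1}{\#(D)}\sum_{d\in D}\mu\circ\phi_d^{-1}$. For an integer $p\ge2$: $E_p^2:=\frac1p\{(l_1,l_2)^t: l_1,l_2\in\mathbb{Z},\ 0\le l_1,l_2\le p-1\}$ and $\mathring{E}_p^2:=E_p^2\setminus\{0\}$. For a finite $D\subset\mathbb{Z}^2$: $m_D(x)=\frac{1}{\#(D)}\sum_{d\in D}e^{2\pi i\langle d,x\rangle}$ for $x\in\mathbb{R}^2$, and $\mathcal{Z}_D^2:=\{x\in[0,1)^2: m_D(x)=0\}$. For a Borel probability measure $\mu$ with compact support on $\mathbb{R}^2$ and a finite or countable $\Lambda\subset\mathbb{R}^2$, let $\mathcal{E}_\Lambda=\{e^{2\pi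 i\langle\lambda,x\rangle}:\lambda\in\Lambda\}$; it is an orthogonal set if the functions corresponding to any two distinct elements of $\Lambda$ are orthogonal in $L^2(\mu)$. The maximal cardinality of the orthogonal exponential functions in $L^2(\mu)$ is $$n^*(\mu):=\sup\{\#\Lambda:\ \mathcal{E}_\Lambda\text{ is a maximal orthogonal set of exponential functions in }L^2(\mu)\}.$$ Define $\widetilde{P}=\frac{p^2}{2}$ if $p$ is even, $\widetilde{P}=\frac{p^2-1}{2}$ if $p>3$ is odd, and $\widetilde{P}=3$ if $p=3$. Let $\mathfrak{M}_p$ be the class of all expanding matrices $M\in M_2(\mathbb{Z})$ with $\gcd(\det(M),p)=1$, and let $M^*$ denote the conjugate transpose of $M$ (here just the transpose). For the given $D$, $\mathfrak{M}_p$ is divided into the two disjoint subclasses $$\mathfrak{M}_p^{(1)}=\Big\{M\in\mathfrak{M}_p:\ \bigcup_{j=1}^{p^2-1}{M^*}^j\mathcal{Z}_D^2\subsetneqq\mathring{E}_p^2\ (\mathrm{mod}\ \mathbb{Z}^2)\Big\},\quad \mathfrak{M}_p^{(2)}=\Big\{M\in\mathfrak{M}_p:\ \bigcup_{j=1}^{p^2-1}{M^*}^j\mathcal{Z}_D^2=\mathring{E}_p^2\ (\mathrm{mod}\ \mathbb{Z}^2)\Big\}.$$ Relations between sets "mod $\mathbb{Z}^2$" mean relations between their images in $\mathbb{R}^2/\mathbb{Z}^2$. *)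

theory Defs
  imports "HOL-Analysis.Analysis" "HOL-Library.Extended_Nat"
begin

abbreviation real_matrix :: "int ^ 'n ^ 'm \<Rightarrow> real ^ 'n ^ 'm" where
  "real_matrix M \<equiv> map_matrix of_int M"

text \<open>All eigenvalues, including the non-real ones, have modulus greater than 1; so eigenvalues
  are those of the complexified matrix.\<close>

definition complex_eigenvalue :: "real ^ 'n ^ 'n \<Rightarrow> complex \<Rightarrow> bool" where
  "complex_eigenvalue M z \<longleftrightarrow>
     (\<exists>v :: complex ^ 'n. v \<noteq> 0 \<and> map_matrix complex_of_real M *v v = z *s v)"

definition expanding :: "real ^ 'n ^ 'n \<Rightarrow> bool" where
  "expanding M \<longleftrightarrow> (\<forall>z. complex_eigenvalue M z \<longrightarrow> cmod z > 1)"

definition int_lattice :: "(real ^ 2) set" where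
  "int_lattice = {x. \<forall>i. x $ i \<in> \<int>}"

text \<open>Congruence modulo the integer lattice. The library quotient \<open>A // mod_lattice\<close> is then
  exactly the image of \<open>A\<close> in the torus, so relations between sets modulo the lattice are relations
  between such quotients.\<close>

definition mod_lattice :: "((real ^ 2) \<times> (real ^ 2)) set" where
  "mod_lattice = {(x, y). x - y \<in> int_lattice}"

definition affine_contraction :: "real ^ 2 ^ 2 \<Rightarrow> real ^ 2 \<Rightarrow> real ^ 2 \<Rightarrow> real ^ 2" where
  "affine_contraction M d x = matrix_inv M *v (x + d)"

text \<open>For an expanding \<open>M\<close> and a finite nonempty \<open>D\<close>, exactly one measure satisfies this predicate
  (Hutchinson); it is the self-affine measure of the pair.\<close>

definition is_self_affine_measure ::
    "real ^ 2 ^ 2 \<Rightarrow> (real ^ 2) set \<Rightarrow> (real ^ 2) measure \<Rightarrow> bool" where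
  "is_self_affine_measure M D \<mu> \<longleftrightarrow>
     sets \<mu> = sets borel \<and> emeasure \<mu> UNIV = 1 \<and>
     (\<forall>A \<in> sets borel.
        measure \<mu> A = 1 / real (card D) * (\<Sum>d\<in>D. measure \<mu> (affine_contraction M d -` A)))"

definition grid :: "nat \<Rightarrow> (real ^ 2) set" where
  "grid p = {(\<chi> i. of_int (l $ i) / of_nat p) | l :: int ^ 2. \<forall>i. 0 \<le> l $ i \<and> l $ i \<le> int p - 1}"

definition punctured_grid :: "nat \<Rightarrow> (real ^ 2) set" where
  "punctured_grid p = grid p - {0}"

definition exponential :: "real ^ 2 \<Rightarrow> real ^ 2 \<Rightarrow> complex" where
  "exponential \<xi> x = exp (2 * of_real pi * \<i> * of_real (\<xi> \<bullet> x))"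

definition mask :: "(real ^ 2) set \<Rightarrow> real ^ 2 \<Rightarrow> complex" where
  "mask D x = 1 / of_nat (card D) * (\<Sum>d\<in>D. exponential d x)"

definition mask_zeros :: "(real ^ 2) set \<Rightarrow> (real ^ 2) set" where
  "mask_zeros D = {x. (\<forall>i. 0 \<le> x $ i \<and> x $ i < 1) \<and> mask D x = 0}"

definition orthogonal_exponentials :: "(real ^ 2) measure \<Rightarrow> (real ^ 2) set \<Rightarrow> bool" where
  "orthogonal_exponentials \<mu> \<Lambda> \<longleftrightarrow>
     (\<forall>\<xi>\<in>\<Lambda>. \<forall>\<eta>\<in>\<Lambda>. \<xi> \<noteq> \<eta> \<longrightarrow> (LINT x|\<mu>. exponential \<xi> x * cnj (exponential \<eta> x)) = 0)"

definition maximal_orthogonal_exponentials :: "(real ^ 2) measure \<Rightarrow> (real ^ 2) set \<Rightarrow> bool" where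
  "maximal_orthogonal_exponentials \<mu> \<Lambda> \<longleftrightarrow>
     countable \<Lambda> \<and> orthogonal_exponentials \<mu> \<Lambda> \<and>
     (\<forall>\<Lambda>'. countable \<Lambda>' \<and> orthogonal_exponentials \<mu> \<Lambda>' \<and> \<Lambda> \<subseteq> \<Lambda>' \<longrightarrow> \<Lambda>' = \<Lambda>)"

definition ext_card :: "'a set \<Rightarrow> enat" where
  "ext_card A = (if finite A then enat (card A) else \<infinity>)"

definition n_star :: "(real ^ 2) measure \<Rightarrow> enat" where
  "n_star \<mu> = (SUP \<Lambda> \<in> {\<Lambda>. maximal_orthogonal_exponentials \<mu> \<Lambda>}. ext_card \<Lambda>)"

text \<open>Both divisions are exact.\<close>

definition P_tilde :: "nat \<Rightarrow> nat" where
  "P_tilde p = (if even p then p ^ 2 div 2 else if p = 3 then 3 else (p ^ 2 - 1) div 2)"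

definition matrix_class :: "nat \<Rightarrow> (int ^ 2 ^ 2) set" where
  "matrix_class p = {M. expanding (real_matrix M) \<and> gcd (det M) (int p) = 1}"

text \<open>Matrix powers are iterates of the linear map: \<open>^\<close> on vectors of vectors would be the
  componentwise power.\<close>

definition zero_orbit :: "nat \<Rightarrow> (real ^ 2) set \<Rightarrow> int ^ 2 ^ 2 \<Rightarrow> (real ^ 2) set" where
  "zero_orbit p D M =
     (\<Union>j\<in>{1..p ^ 2 - 1}. ((\<lambda>x. transpose (real_matrix M) *v x) ^^ j) ` mask_zeros D)"

definition matrix_class1 :: "nat \<Rightarrow> (real ^ 2) set \<Rightarrow> (int ^ 2 ^ 2) set" where
  "matrix_class1 p D =
     {M \<in> matrix_class p. zero_orbit p D M // mod_lattice \<subset> punctured_grid p // mod_lattice}"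

definition matrix_class2 :: "nat \<Rightarrow> (real ^ 2) set \<Rightarrow> (int ^ 2 ^ 2) set" where
  "matrix_class2 p D =
     {M \<in> matrix_class p. zero_orbit p D M // mod_lattice = punctured_grid p // mod_lattice}"

end

theory Submission
  imports Defs "HOL-Probability.Probability"
begin

text \<open>Write \<open>L\<close> for the transpose of \<open>M\<close>. Since the Fourier transform of the self-affine measure is
  the infinite product of the mask along the backward iterates of \<open>L\<close>, its zeros are exactly the
  points \<open>L ^^ j\<close> applied to a zero of the mask, with \<open>j \<ge> 1\<close>. All of them lie in \<open>(1/p) \<int>\<^sup>2\<close> but not
  in \<open>\<int>\<^sup>2\<close>, so an orthogonal set injects into a group of order \<open>p\<^sup>2\<close>. If the orbit misses a class
  \<open>b\<close>, an orthogonal set \<open>\<Lambda>\<close> is disjoint from its translate by \<open>b\<close> even modulo the lattice, so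
  \<open>2 |\<Lambda>| \<le> p\<^sup>2\<close>; for \<open>p = 3\<close> the three translates by multiples of \<open>b\<close> give \<open>3 |\<Lambda>| \<le> 9\<close>. If the orbit
  misses nothing, the image of the grid under a high power of \<open>L\<close> is orthogonal.\<close>

subsection \<open>Expanding matrices\<close>

text \<open>The recurrence factors: \<open>w\<close> satisfies a first-order recurrence with ratio
  \<open>1 / b\<close> and decays geometrically, and \<open>c\<close> satisfies one with ratio
  \<open>1 / a\<close> driven by \<open>w\<close>. The factor \<open>n\<close> in
  \<open>c_le\<close> absorbs the resonance of equal roots, so all cases are treated at
  once.\<close>

lemma tendsto_zero_linear_recurrence:
  fixes c :: "nat \<Rightarrow> complex"
  assumes a: "cmod a > 1" and b: "cmod b > 1"
    and rec: "\<And>n. a * b * c (n + 2) - (a + b) * c (n + 1) + c n = 0"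
  shows "c \<longlonglongrightarrow> 0"
proof -
  define w where "w n = a * c (n + 1) - c n" for n
  define r where "r = max (inverse (cmod a)) (inverse (cmod b))"
  define K where "K = cmod (w 0)"
  have nz: "a \<noteq> 0" "b \<noteq> 0" using a b by auto
  have r: "0 < r" "r < 1" using a b nz by (auto simp: r_def less_max_iff_disj field_simps)
  have "b * w (Suc n) = w n" for n
    using rec[of n] by (simp add: w_def algebra_simps)
  then have w_Suc: "w (Suc n) = w n / b" for n
    using nz by (simp add: field_simps)
  have w_le: "cmod (w n) \<le> K * r ^ n" for n
  proof (induction n)
    case (Suc n)
    have "cmod (w (Suc n)) = inverse (cmod b) * cmod (w n)"
      by (simp add: w_Suc norm_divide field_simps)
    also have "\<dots> \<le> r * (K * r ^ n)"
      using Suc r by (intro mult_mono) (auto simp: r_def)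
    finally show ?case by (simp add: mult_ac)
  qed (simp add: K_def)
  have c_Suc: "cmod (c (Suc n)) \<le> r * (cmod (c n) + cmod (w n))" for n
  proof -
    have "c (Suc n) = (c n + w n) / a" using nz by (simp add: w_def)
    then have "cmod (c (Suc n)) = inverse (cmod a) * cmod (c n + w n)"
      by (simp add: norm_divide field_simps)
    also have "\<dots> \<le> r * (cmod (c n) + cmod (w n))"
      using r by (intro mult_mono norm_triangle_ineq) (auto simp: r_def)
    finally show ?thesis .
  qed
  have c_le: "cmod (c n) \<le> cmod (c 0) * r ^ n + K * (of_nat n * r ^ n)" for n
  proof (induction n)
    case (Suc n)
    have "cmod (c (Suc n)) \<le> r * (cmod (c n) + cmod (w n))" by (rule c_Suc)
    also have "\<dots> \<le> r * ((cmod (c 0) * r ^ n + K * (of_nat n * r ^ n)) + K * r ^ n)"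
      using Suc w_le[of n] r by (intro mult_left_mono add_mono) auto
    finally show ?case by (simp add: algebra_simps)
  qed simp
  have "(\<lambda>n. cmod (c 0) * r ^ n + K * (of_nat n * r ^ n)) \<longlonglongrightarrow> cmod (c 0) * 0 + K * 0"
    using r by (intro tendsto_intros LIMSEQ_power_zero powser_times_n_limit_0) auto
  then have "(\<lambda>n. cmod (c 0) * r ^ n + K * (of_nat n * r ^ n)) \<longlonglongrightarrow> 0" by simp
  then show ?thesis
    by (rule Lim_null_comparison[rotated]) (simp add: c_le)
qed

text \<open>A root makes \<open>A - z\<close> singular over the complex numbers; a kernel vector is
  the eigenvector.\<close>

lemma complex_eigenvalue_if_char_poly_zero:
  fixes A :: "real ^ 2 ^ 2"
  assumes "z ^ 2 - of_real (A $ 1 $ 1 + A $ 2 $ 2) * z + of_real (det A) = 0"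
  shows "complex_eigenvalue A z"
proof -
  let ?B = "map_matrix complex_of_real A - mat z"
  have "det ?B = 0"
    using assms by (simp add: det_2 mat_def power2_eq_square algebra_simps)
  then have "\<not> invertible ?B" by (simp add: invertible_det_nz)
  then obtain v where v: "v \<noteq> 0" "?B *v v = 0"
    unfolding invertible_left_inverse matrix_left_invertible_ker by blast
  have "mat z *v v = z *s v"
    by (simp add: vec_eq_iff matrix_vector_mult_def mat_def if_distrib if_distribR cong: if_cong)
  then have "map_matrix complex_of_real A *v v = z *s v"
    using v(2) by (simp add: matrix_vector_mult_diff_rdistrib)
  with v(1) show ?thesis unfolding complex_eigenvalue_def by blast
qed

text \<open>The quadratic formula with a complex square root of the discriminant covers real,
  conjugate and double roots alike. Sum and product are recorded because they are the coefficients
  of the recurrence above.\<close>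

lemma expanding_char_poly_roots:
  fixes A :: "real ^ 2 ^ 2"
  assumes "expanding A"
  obtains a b where "cmod a > 1" "cmod b > 1"
    "a + b = of_real (A $ 1 $ 1 + A $ 2 $ 2)" "a * b = of_real (det A)"
proof -
  define t where "t = complex_of_real (A $ 1 $ 1 + A $ 2 $ 2)"
  define d where "d = complex_of_real (det A)"
  define s where "s = csqrt (t ^ 2 - 4 * d)"
  have s: "s * s = t * t - 4 * d" by (metis power2_csqrt power2_eq_square s_def)
  have "((t + s) / 2) ^ 2 - t * ((t + s) / 2) + d = (s * s - (t * t - 4 * d)) / 4"
    "((t - s) / 2) ^ 2 - t * ((t - s) / 2) + d = (s * s - (t * t - 4 * d)) / 4"
    by (simp_all add: field_simps power2_eq_square)
  then have "complex_eigenvalue A ((t + s) / 2)" "complex_eigenvalue A ((t - s) / 2)"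
    unfolding s t_def d_def by (intro complex_eigenvalue_if_char_poly_zero; simp)+
  moreover have "(t + s) / 2 + (t - s) / 2 = t" "(t + s) / 2 * ((t - s) / 2) = (t * t - s * s) / 4"
    by (simp_all add: field_simps)
  moreover have "(t * t - s * s) / 4 = d" by (simp add: s)
  ultimately show thesis
    using assms that[of "(t + s) / 2" "(t - s) / 2"] unfolding expanding_def t_def d_def by metis
qed

lemma expanding_invertible:
  fixes A :: "real ^ 2 ^ 2"
  assumes "expanding A"
  shows "invertible A"
proof -
  obtain a b where "cmod a > 1" "cmod b > 1" "a * b = of_real (det A)"
    using expanding_char_poly_roots[OF assms] by metis
  then have "det A \<noteq> 0" by auto
  then show ?thesis by (simp add: invertible_det_nz)
qed

lemma cayley_hamilton_2:
  fixes A :: "real ^ 2 ^ 2"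
  shows "A *v (A *v x) - (A $ 1 $ 1 + A $ 2 $ 2) *s (A *v x) + det A *s x = 0"
  by (simp add: vec_eq_iff forall_2 matrix_vector_mult_def sum_2 det_2 algebra_simps)

text \<open>Cayley-Hamilton for the transpose, applied at \<open>(N ^^ (n + 2)) x\<close>, shows
  that each coordinate of the backward orbit satisfies the recurrence above; trace and determinant
  do not change under transposition.\<close>

lemma expanding_inverse_iterates_tendsto_zero:
  fixes A :: "real ^ 2 ^ 2" and N :: "real ^ 2 \<Rightarrow> real ^ 2"
  assumes "expanding A" and N: "\<And>x. transpose A *v N x = x"
  shows "(\<lambda>n. (N ^^ n) x) \<longlonglongrightarrow> 0"
proof (rule vec_tendstoI)
  fix i :: 2
  obtain a b where ab: "cmod a > 1" "cmod b > 1"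
    "a + b = of_real (A $ 1 $ 1 + A $ 2 $ 2)" "a * b = of_real (det A)"
    using expanding_char_poly_roots[OF assms(1)] .
  define c where "c n = complex_of_real ((N ^^ n) x $ i)" for n
  have "a * b * c (n + 2) - (a + b) * c (n + 1) + c n = 0" for n
  proof -
    have "(N ^^ n) x - (A $ 1 $ 1 + A $ 2 $ 2) *s (N ^^ (n + 1)) x + det A *s (N ^^ (n + 2)) x = 0"
      using cayley_hamilton_2[of "transpose A" "(N ^^ (n + 2)) x"]
      by (simp add: N det_transpose del: transpose_matrix_vector) (simp add: transpose_def)
    from arg_cong[OF this, of "\<lambda>v. complex_of_real (v $ i)"] show ?thesis
      by (simp add: ab c_def algebra_simps)
  qed
  then have "c \<longlonglongrightarrow> 0" by (rule tendsto_zero_linear_recurrence[OF ab(1,2)])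
  then show "(\<lambda>n. (N ^^ n) x $ i) \<longlonglongrightarrow> 0 $ i"
    unfolding c_def by (simp flip: tendsto_of_real_iff[where 'a = complex])
qed

subsection \<open>The Fourier transform of a self-affine measure\<close>

lemma norm_exponential [simp]: "cmod (exponential \<xi> x) = 1"
  by (simp add: exponential_def)

lemma exponential_0 [simp]: "exponential 0 x = 1"
  by (simp add: exponential_def)

lemma exponential_add_right: "exponential \<xi> (x + y) = exponential \<xi> x * exponential \<xi> y"
  by (simp add: exponential_def inner_add_right distrib_left exp_add)

lemma exponential_commute: "exponential x y = exponential y x"
  by (simp add: exponential_def inner_commute)

lemma exponential_mult_cnj: "exponential \<xi> x * cnj (exponential \<eta> x) = exponential (\<xi> - \<eta>) x"
  by (simp add: exponential_def exp_cnj inner_diff_left right_diff_distrib exp_diff exp_minus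
      divide_inverse)

lemma continuous_exponential: "continuous_on S (exponential \<xi>)"
  unfolding exponential_def by (intro continuous_intros)

lemma exponential_measurable [measurable]: "exponential \<xi> \<in> borel_measurable borel"
  by (intro borel_measurable_continuous_onI continuous_exponential)

definition fourier :: "(real ^ 2) measure \<Rightarrow> real ^ 2 \<Rightarrow> complex" where
  "fourier \<mu> \<xi> = (LINT x|\<mu>. exponential \<xi> x)"

lemma orthogonal_exponentials_iff:
  "orthogonal_exponentials \<mu> \<Lambda> \<longleftrightarrow>
     (\<forall>\<xi>\<in>\<Lambda>. \<forall>\<eta>\<in>\<Lambda>. \<xi> \<noteq> \<eta> \<longrightarrow> fourier \<mu> (\<xi> - \<eta>) = 0)"
  by (simp add: orthogonal_exponentials_def exponential_mult_cnj fourier_def)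

lemma is_self_affine_measure_prob_space:
  assumes "is_self_affine_measure A D \<mu>"
  shows "prob_space \<mu>"
proof
  have "space \<mu> = UNIV"
    using assms sets_eq_imp_space_eq[of \<mu> borel] by (simp add: is_self_affine_measure_def)
  then show "emeasure \<mu> (space \<mu>) = 1"
    using assms by (simp add: is_self_affine_measure_def)
qed

lemma affine_contraction_measurable [measurable]: "affine_contraction A d \<in> borel_measurable borel"
proof (rule borel_measurable_continuous_onI)
  have "continuous_on UNIV (\<lambda>x. matrix_inv A *v (x + d))"
    by (intro bounded_linear.continuous_on[OF matrix_vector_mul_bounded_linear] continuous_intros)
  then show "continuous_on UNIV (affine_contraction A d)"
    by (simp add: affine_contraction_def[abs_def])
qed

text \<open>The defining equation speaks about sets. Read as a mixture over a uniformly random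
  digit, it becomes an identity of measures that can be integrated against.\<close>

lemma is_self_affine_measure_eq_bind:
  assumes \<mu>: "is_self_affine_measure A D \<mu>" and D: "finite D" "D \<noteq> {}"
  shows "\<mu> = measure_pmf (pmf_of_set D) \<bind> (\<lambda>d. distr \<mu> borel (affine_contraction A d))"
    (is "_ = ?\<nu>")
proof -
  interpret prob_space \<mu> by (rule is_self_affine_measure_prob_space[OF \<mu>])
  have sets_\<mu> [measurable_cong]: "sets \<mu> = sets borel"
    using \<mu> by (simp add: is_self_affine_measure_def)
  have space: "space \<mu> = UNIV" using sets_eq_imp_space_eq[OF sets_\<mu>] by simp
  have K: "(\<lambda>d. distr \<mu> borel (affine_contraction A d))
      \<in> measure_pmf (pmf_of_set D) \<rightarrow>\<^sub>M subprob_algebra borel"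
    by (auto simp: space_subprob_algebra intro!: prob_space_imp_subprob_space prob_space_distr)
  have sets: "sets ?\<nu> = sets borel" by (rule sets_bind) auto
  show ?thesis
  proof (rule measure_eqI)
    show "sets \<mu> = sets ?\<nu>" using sets sets_\<mu> by simp
    fix S assume "S \<in> sets \<mu>"
    then have S [measurable]: "S \<in> sets borel" using sets_\<mu> by simp
    have "emeasure ?\<nu> S = (\<integral>\<^sup>+d. emeasure (distr \<mu> borel (affine_contraction A d)) S
        \<partial>measure_pmf (pmf_of_set D))"
      by (rule emeasure_bind[OF _ K S]) simp
    also have "\<dots> = (\<Sum>d\<in>D. emeasure (distr \<mu> borel (affine_contraction A d)) S) / card D"
      using D by (simp add: nn_integral_pmf_of_set)
    also have "\<dots> = (\<Sum>d\<in>D. ennreal (measure \<mu> (affine_contraction A d -` S))) / card D"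
      by (simp add: emeasure_distr space emeasure_eq_measure)
    also have "\<dots> = ennreal (1 / card D * (\<Sum>d\<in>D. measure \<mu> (affine_contraction A d -` S)))"
      using D by (simp add: sum_nonneg divide_ennreal card_gt_0_iff ennreal_of_nat_eq_real_of_nat)
    also have "\<dots> = emeasure \<mu> S"
      using \<mu> S by (simp add: is_self_affine_measure_def emeasure_eq_measure)
    finally show "emeasure \<mu> S = emeasure ?\<nu> S" ..
  qed
qed

lemma integral_self_affine_real:
  fixes f :: "real ^ 2 \<Rightarrow> real"
  assumes \<mu>: "is_self_affine_measure A D \<mu>" and D: "finite D" "D \<noteq> {}"
    and f [measurable]: "f \<in> borel_measurable borel" and B: "\<And>x. \<bar>f x\<bar> \<le> B"
  shows "(LINT x|\<mu>. f x) = (\<Sum>d\<in>D. LINT x|\<mu>. f (affine_contraction A d x)) / card D"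
proof -
  interpret prob_space \<mu> by (rule is_self_affine_measure_prob_space[OF \<mu>])
  have [measurable_cong]: "sets \<mu> = sets borel" using \<mu> by (simp add: is_self_affine_measure_def)
  have "(LINT x|\<mu>. f x) = (LINT x|(measure_pmf (pmf_of_set D) \<bind>
      (\<lambda>d. distr \<mu> borel (affine_contraction A d))). f x)"
    using is_self_affine_measure_eq_bind[OF \<mu> D] by simp
  also have "\<dots> = (LINT d|measure_pmf (pmf_of_set D).
      LINT x|distr \<mu> borel (affine_contraction A d). f x)"
  proof (rule integral_bind[where K = borel and B = B and B' = 1])
    show "(\<lambda>d. distr \<mu> borel (affine_contraction A d))
        \<in> measure_pmf (pmf_of_set D) \<rightarrow>\<^sub>M subprob_algebra borel"
      by (auto simp: space_subprob_algebra intro!: prob_space_imp_subprob_space prob_space_distr)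
    show "AE d in measure_pmf (pmf_of_set D).
        emeasure (distr \<mu> borel (affine_contraction A d)) (space (distr \<mu> borel (affine_contraction A d)))
          \<le> ennreal 1"
      by (auto simp: emeasure_distr emeasure_eq_measure)
  qed (use B in \<open>auto simp: measure_pmf.finite_measure_axioms\<close>)
  also have "\<dots> = (\<Sum>d\<in>D. LINT x|\<mu>. f (affine_contraction A d x)) / card D"
    using D by (simp add: integral_pmf_of_set integral_distr)
  finally show ?thesis .
qed

text \<open>Real and imaginary parts inherit the bound \<open>B\<close>, so the real version applies
  to each.\<close>

lemma integral_self_affine_complex:
  fixes f :: "real ^ 2 \<Rightarrow> complex"
  assumes \<mu>: "is_self_affine_measure A D \<mu>" and D: "finite D" "D \<noteq> {}"
    and f [measurable]: "f \<in> borel_measurable borel" and B: "\<And>x. cmod (f x) \<le> B"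
  shows "(LINT x|\<mu>. f x) = (\<Sum>d\<in>D. LINT x|\<mu>. f (affine_contraction A d x)) / card D"
proof -
  interpret prob_space \<mu> by (rule is_self_affine_measure_prob_space[OF \<mu>])
  have [measurable_cong]: "sets \<mu> = sets borel" using \<mu> by (simp add: is_self_affine_measure_def)
  have "integrable \<mu> f" "integrable \<mu> (\<lambda>x. f (affine_contraction A d x))" for d
    by (rule integrable_const_bound[where B = B]; use B in simp)+
  moreover have "\<bar>Re (f x)\<bar> \<le> B" "\<bar>Im (f x)\<bar> \<le> B" for x
    using B[of x] abs_Re_le_cmod[of "f x"] abs_Im_le_cmod[of "f x"] by linarith+
  ultimately show ?thesis
    using integral_self_affine_real[OF \<mu> D, of "\<lambda>x. Re (f x)" B]
      integral_self_affine_real[OF \<mu> D, of "\<lambda>x. Im (f x)" B]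
    by (simp add: complex_eq_iff)
qed

text \<open>Moving the inverse matrix across the inner product splits the exponential at a
  contracted point into a digit factor and the exponential with frequency \<open>N \<xi>\<close>;
  averaging the digit factors gives the mask.\<close>

lemma fourier_self_affine:
  assumes \<mu>: "is_self_affine_measure A D \<mu>" and D: "finite D" "D \<noteq> {}"
  defines "N \<equiv> (\<lambda>x. transpose (matrix_inv A) *v x)"
  shows "fourier \<mu> \<xi> = mask D (N \<xi>) * fourier \<mu> (N \<xi>)"
proof -
  have "exponential \<xi> (affine_contraction A d x) = exponential d (N \<xi>) * exponential (N \<xi>) x"
    for d x
  proof -
    have "\<xi> \<bullet> (matrix_inv A *v (x + d)) = N \<xi> \<bullet> (x + d)"
      unfolding N_def by (metis dot_lmul_matrix transpose_matrix_vector)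
    then have "exponential \<xi> (affine_contraction A d x) = exponential (N \<xi>) (x + d)"
      by (simp only: exponential_def affine_contraction_def)
    then show ?thesis
      by (simp add: exponential_add_right exponential_commute[of d] mult.commute)
  qed
  moreover have "fourier \<mu> \<xi> =
      (\<Sum>d\<in>D. LINT x|\<mu>. exponential \<xi> (affine_contraction A d x)) / card D"
    unfolding fourier_def by (rule integral_self_affine_complex[OF \<mu> D, where B = 1]) auto
  ultimately show ?thesis
    by (simp add: fourier_def mask_def sum_distrib_right)
qed

lemma fourier_tendsto_1:
  assumes \<mu>: "is_self_affine_measure A D \<mu>" and y: "y \<longlonglongrightarrow> 0"
  shows "(\<lambda>n. fourier \<mu> (y n)) \<longlonglongrightarrow> 1"
proof -
  interpret prob_space \<mu> by (rule is_self_affine_measure_prob_space[OF \<mu>])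
  have [measurable_cong]: "sets \<mu> = sets borel" using \<mu> by (simp add: is_self_affine_measure_def)
  have "(\<lambda>n. LINT x|\<mu>. exponential (y n) x) \<longlonglongrightarrow> (LINT x|\<mu>. 1)"
  proof (rule integral_dominated_convergence[where w = "\<lambda>_. 1"])
    show "AE x in \<mu>. (\<lambda>n. exponential (y n) x) \<longlonglongrightarrow> 1"
    proof (rule AE_I2)
      fix x
      have "isCont (exponential x) 0"
        using continuous_exponential[of UNIV x] by (simp add: continuous_on_eq_continuous_at)
      then have "(\<lambda>n. exponential x (y n)) \<longlonglongrightarrow> exponential x 0"
        using y by (rule isCont_tendsto_compose)
      then show "(\<lambda>n. exponential (y n) x) \<longlonglongrightarrow> 1"
        by (simp add: exponential_commute[of x])
    qed
  qed auto
  then show ?thesis by (simp add: fourier_def prob_space)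
qed

text \<open>After \<open>n\<close> steps of the functional equation the remaining factor is the
  transform at \<open>(N ^^ n) \<xi>\<close>, which tends to 1. Fixing an \<open>n\<close> where it
  is nonzero, a zero of the transform must come from one of finitely many mask factors.\<close>

lemma fourier_eq_0_iff:
  assumes "expanding A" and \<mu>: "is_self_affine_measure A D \<mu>" and D: "finite D" "D \<noteq> {}"
  defines "L \<equiv> (\<lambda>x. transpose A *v x)"
  shows "fourier \<mu> \<xi> = 0 \<longleftrightarrow> (\<exists>j\<ge>1. \<exists>z. mask D z = 0 \<and> \<xi> = (L ^^ j) z)"
proof -
  define N where "N = (\<lambda>x :: real ^ 2. transpose (matrix_inv A) *v x)"
  have inv: "A ** matrix_inv A = mat 1" "matrix_inv A ** A = mat 1"
    using someI_ex[OF expanding_invertible[OF assms(1), unfolded invertible_def]]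
    by (simp_all add: matrix_inv_def)
  have LN: "L (N x) = x" and NL: "N (L x) = x" for x
    by (simp_all add: L_def N_def matrix_vector_mul_assoc inv del: transpose_matrix_vector
        flip: matrix_transpose_mul)
  have LN': "(L ^^ j) ((N ^^ j) x) = x" and NL': "(N ^^ j) ((L ^^ j) x) = x" for j x
    by (induction j arbitrary: x) (simp_all add: LN NL funpow_swap1)
  have step: "fourier \<mu> \<xi> = mask D (N \<xi>) * fourier \<mu> (N \<xi>)" for \<xi>
    unfolding N_def by (rule fourier_self_affine[OF \<mu> D])
  have iter: "fourier \<mu> \<xi> = (\<Prod>j\<in>{1..n}. mask D ((N ^^ j) \<xi>)) * fourier \<mu> ((N ^^ n) \<xi>)" for n
  proof (induction n)
    case (Suc n)
    then show ?case using step[of "(N ^^ n) \<xi>"] by (simp add: mult.assoc)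
  qed simp
  have "(\<lambda>n. fourier \<mu> ((N ^^ n) \<xi>)) \<longlonglongrightarrow> 1"
    using LN by (intro fourier_tendsto_1[OF \<mu>] expanding_inverse_iterates_tendsto_zero[OF assms(1)])
      (simp add: L_def)
  then have "\<forall>\<^sub>F n in sequentially. fourier \<mu> ((N ^^ n) \<xi>) \<noteq> 0"
    by (rule tendsto_imp_eventually_ne) simp
  then obtain n where n: "fourier \<mu> ((N ^^ n) \<xi>) \<noteq> 0"
    by (auto simp: eventually_sequentially)
  show ?thesis
  proof
    assume "fourier \<mu> \<xi> = 0"
    with iter[of n] n obtain j where "j \<ge> 1" "mask D ((N ^^ j) \<xi>) = 0" by auto
    with LN' show "\<exists>j\<ge>1. \<exists>z. mask D z = 0 \<and> \<xi> = (L ^^ j) z" by metis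
  next
    assume "\<exists>j\<ge>1. \<exists>z. mask D z = 0 \<and> \<xi> = (L ^^ j) z"
    then obtain j where "j \<ge> 1" "mask D ((N ^^ j) \<xi>) = 0" using NL' by metis
    with iter[of j] show "fourier \<mu> \<xi> = 0" by (force simp: prod_zero_iff)
  qed
qed

subsection \<open>Congruence modulo the integer lattice\<close>

lemma int_lattice_diff [intro]: "x \<in> int_lattice \<Longrightarrow> y \<in> int_lattice \<Longrightarrow> x - y \<in> int_lattice"
  by (simp add: int_lattice_def)

lemma int_lattice_add [intro]: "x \<in> int_lattice \<Longrightarrow> y \<in> int_lattice \<Longrightarrow> x + y \<in> int_lattice"
  by (simp add: int_lattice_def)

lemma int_lattice_uminus_iff [simp]: "- x \<in> int_lattice \<longleftrightarrow> x \<in> int_lattice"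
  by (simp add: int_lattice_def)

lemma int_lattice_0 [simp]: "0 \<in> int_lattice"
  by (simp add: int_lattice_def)

lemma int_lattice_scaleR_nat [intro]: "x \<in> int_lattice \<Longrightarrow> real n *\<^sub>R x \<in> int_lattice"
  by (simp add: int_lattice_def)

lemma int_lattice_minus_commute: "x - y \<in> int_lattice \<longleftrightarrow> y - x \<in> int_lattice"
  using int_lattice_uminus_iff[of "x - y"] by simp

lemma equiv_mod_lattice: "equiv UNIV mod_lattice"
proof (rule equivI)
  show "refl mod_lattice" by (simp add: refl_on_def mod_lattice_def)
  show "sym mod_lattice" by (simp add: sym_def mod_lattice_def int_lattice_minus_commute)
  show "trans mod_lattice"
  proof (rule transI)
    fix x y z assume "(x, y) \<in> mod_lattice" "(y, z) \<in> mod_lattice"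
    then have "(x - y) + (y - z) \<in> int_lattice" unfolding mod_lattice_def by blast
    then show "(x, z) \<in> mod_lattice" by (simp add: mod_lattice_def)
  qed
qed auto

lemma mod_lattice_class_eq_iff:
  "mod_lattice `` {x} = mod_lattice `` {y} \<longleftrightarrow> x - y \<in> int_lattice"
  using eq_equiv_class_iff[OF equiv_mod_lattice] by (simp add: mod_lattice_def)

text \<open>The canonical representative modulo the lattice, in the half-open unit square that
  contains \<open>mask_zeros\<close> and \<open>grid\<close>.\<close>

definition frac_vec :: "real ^ 2 \<Rightarrow> real ^ 2" where
  "frac_vec x = (\<chi> i. frac (x $ i))"

lemma frac_vec_bounds: "0 \<le> frac_vec x $ i \<and> frac_vec x $ i < 1"
  by (simp add: frac_vec_def frac_lt_1)

lemma frac_vec_cong: "x - frac_vec x \<in> int_lattice"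
  by (simp add: frac_vec_def int_lattice_def frac_def)

lemma frac_vec_eq_imp: "frac_vec x = frac_vec y \<Longrightarrow> x - y \<in> int_lattice"
  using int_lattice_diff[OF frac_vec_cong[of x] frac_vec_cong[of y]] by simp

lemma exponential_lattice_eq:
  assumes "d \<in> int_lattice" "x - y \<in> int_lattice"
  shows "exponential d x = exponential d y"
proof -
  have "d \<bullet> (x - y) \<in> \<int>"
    using assms by (auto simp: inner_vec_def sum_2 int_lattice_def)
  then obtain k where k: "d \<bullet> x = d \<bullet> y + of_int k"
    by (auto simp: inner_diff_right elim!: Ints_cases) (metis add.commute diff_add_cancel)
  have "exponential d x = exponential d y * exp (of_int k * (2 * of_real pi * \<i>))"
    by (simp add: exponential_def k distrib_left exp_add mult_ac)
  moreover have "exp (of_int k * (2 * of_real pi * \<i>)) = 1"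
    using exp_integer_2pi[of "of_int k"] by (simp add: mult_ac)
  ultimately show ?thesis by simp
qed

lemma mask_lattice_eq:
  assumes "D \<subseteq> int_lattice" "x - y \<in> int_lattice"
  shows "mask D x = mask D y"
  using assms exponential_lattice_eq unfolding mask_def
  by (intro arg_cong2[of _ _ _ _ "(*)"] refl sum.cong) auto

text \<open>For positive \<open>p\<close> this is the group \<open>(1/p) \<int>\<^sup>2\<close>. Its
  image in the torus is the \<open>p\<close>-torsion, with \<open>grid p\<close> as a set of
  representatives.\<close>

definition frac_lattice :: "nat \<Rightarrow> (real ^ 2) set" where
  "frac_lattice p = {x. real p *\<^sub>R x \<in> int_lattice}"

lemma frac_lattice_diff [intro]:
  "x \<in> frac_lattice p \<Longrightarrow> y \<in> frac_lattice p \<Longrightarrow> x - y \<in> frac_lattice p"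
  unfolding frac_lattice_def by (auto simp: scaleR_diff_right)

lemma frac_lattice_add [intro]:
  "x \<in> frac_lattice p \<Longrightarrow> y \<in> frac_lattice p \<Longrightarrow> x + y \<in> frac_lattice p"
  unfolding frac_lattice_def by (auto simp: scaleR_add_right)

lemma int_lattice_imp_frac_lattice: "x \<in> int_lattice \<Longrightarrow> x \<in> frac_lattice p"
  by (auto simp: frac_lattice_def)

lemma frac_lattice_scaleR_nat:
  "x \<in> frac_lattice p \<Longrightarrow> real n *\<^sub>R x \<in> frac_lattice p"
  using int_lattice_scaleR_nat[of "real p *\<^sub>R x" n] by (simp add: frac_lattice_def mult.commute)

lemma grid_eq:
  assumes "p > 0"
  shows "grid p = {x \<in> frac_lattice p. \<forall>i. 0 \<le> x $ i \<and> x $ i < 1}"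
proof (intro set_eqI iffI)
  fix x assume "x \<in> grid p"
  then obtain l :: "int ^ 2" where x: "x = (\<chi> i. of_int (l $ i) / of_nat p)"
    and l: "\<And>i. 0 \<le> l $ i" "\<And>i. l $ i \<le> int p - 1" unfolding grid_def by blast
  have "real_of_int (l $ i) < real p" for i using l(2)[of i] by linarith
  with l assms show "x \<in> {x \<in> frac_lattice p. \<forall>i. 0 \<le> x $ i \<and> x $ i < 1}"
    by (simp add: x frac_lattice_def int_lattice_def)
next
  fix x assume x: "x \<in> {x \<in> frac_lattice p. \<forall>i. 0 \<le> x $ i \<and> x $ i < 1}"
  define l :: "int ^ 2" where "l = (\<chi> i. \<lfloor>real p * x $ i\<rfloor>)"
  have "of_int (l $ i) = real p * x $ i" for i
    using x unfolding l_def frac_lattice_def int_lattice_def by simp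
  moreover have "0 \<le> real p * x $ i \<and> real p * x $ i < real p" for i
    using x assms by simp
  ultimately have l: "of_int (l $ i) = real p * x $ i" "0 \<le> l $ i" "l $ i < int p" for i
    by (smt (verit) of_int_0_le_iff of_int_less_iff of_int_of_nat_eq)+
  have "x = (\<chi> i. of_int (l $ i) / of_nat p)"
    using assms by (simp add: vec_eq_iff l(1))
  moreover have "\<forall>i. 0 \<le> l $ i \<and> l $ i \<le> int p - 1"
    using l(2,3) by fastforce
  ultimately show "x \<in> grid p" unfolding grid_def by blast
qed

lemma card_grid:
  assumes "p > 0"
  shows "finite (grid p)" "card (grid p) = p ^ 2"
proof -
  define f where "f = (\<lambda>(a :: nat, b :: nat). vector [real a / real p, real b / real p] :: real ^ 2)"
  have "grid p = f ` ({..<p} \<times> {..<p})"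
  proof (intro set_eqI iffI)
    fix x assume "x \<in> grid p"
    then obtain l :: "int ^ 2" where x: "x = (\<chi> i. of_int (l $ i) / of_nat p)"
      and l: "\<And>i. 0 \<le> l $ i" "\<And>i. l $ i \<le> int p - 1" unfolding grid_def by blast
    have "x = f (nat (l $ 1), nat (l $ 2))"
      using l(1) by (simp add: x f_def vec_eq_iff forall_2)
    moreover have "nat (l $ i) < p" for i using l(1,2)[of i] assms by linarith
    ultimately show "x \<in> f ` ({..<p} \<times> {..<p})" by auto
  next
    fix x assume "x \<in> f ` ({..<p} \<times> {..<p})"
    then obtain a b where "x = f (a, b)" "a < p" "b < p" by auto
    then have "x = (\<chi> i. of_int ((vector [int a, int b] :: int ^ 2) $ i) / of_nat p)"
      "\<forall>i. 0 \<le> (vector [int a, int b] :: int ^ 2) $ i \<and> (vector [int a, int b] :: int ^ 2) $ i \<le> int p - 1"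
      by (simp_all add: f_def vec_eq_iff forall_2)
    then show "x \<in> grid p" unfolding grid_def by blast
  qed
  moreover have "inj_on f ({..<p} \<times> {..<p})"
    using assms by (auto simp: inj_on_def f_def vec_eq_iff forall_2)
  ultimately show "finite (grid p)" "card (grid p) = p ^ 2"
    by (auto simp: card_image power2_eq_square)
qed

lemma frac_vec_in_grid:
  assumes "p > 0" "x \<in> frac_lattice p"
  shows "frac_vec x \<in> grid p"
proof -
  have "x - (x - frac_vec x) \<in> frac_lattice p"
    using assms(2) frac_vec_cong int_lattice_imp_frac_lattice by blast
  then show ?thesis using assms(1) frac_vec_bounds by (simp add: grid_eq)
qed

lemma grid_inter_int_lattice:
  assumes "p > 0" "x \<in> grid p" "x \<in> int_lattice"
  shows "x = 0"
proof -
  have "x $ i = 0" for i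
    using assms frac_eq[of "x $ i"] frac_eq_0_iff[of "x $ i"]
    by (simp add: grid_eq int_lattice_def)
  then show ?thesis by (simp add: vec_eq_iff)
qed

text \<open>Only differences are assumed to lie in the group, so the family is first translated by
  one of its members; \<open>frac_vec\<close> then embeds it into the grid. An indexed family is
  used so that pairs of a frequency and a multiple of a translation can be counted too.\<close>

lemma card_incongruent_family_le:
  fixes f :: "'a \<Rightarrow> real ^ 2"
  assumes p: "p > 0"
    and diff: "\<And>i j. i \<in> I \<Longrightarrow> j \<in> I \<Longrightarrow> i \<noteq> j \<Longrightarrow> f i - f j \<in> frac_lattice p - int_lattice"
  shows "finite I \<and> card I \<le> p ^ 2"
proof (cases "I = {}")
  case False
  then obtain k where k: "k \<in> I" by blast
  define g where "g i = frac_vec (f i - f k)" for i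
  have "inj_on g I"
  proof (rule inj_onI, rule ccontr)
    fix i j assume "i \<in> I" "j \<in> I" "g i = g j" "i \<noteq> j"
    then show False
      using frac_vec_eq_imp[of "f i - f k" "f j - f k"] diff[of i j] by (simp add: g_def)
  qed
  moreover have "g ` I \<subseteq> grid p"
  proof
    fix x assume "x \<in> g ` I"
    then obtain i where "i \<in> I" "x = g i" by blast
    then show "x \<in> grid p"
      using diff[of i k] k p unfolding g_def
      by (cases "i = k") (auto intro!: frac_vec_in_grid int_lattice_imp_frac_lattice)
  qed
  ultimately show ?thesis
    using card_grid[OF p] card_inj_on_le inj_on_finite by metis
qed simp

text \<open>The translates of \<open>\<Lambda>\<close> by the multiples of \<open>b\<close> are still pairwise incongruent, which divides
  the trivial bound by the number of translates.\<close>

lemma card_avoiding_le: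
  assumes p: "p > 0" and b: "b \<in> frac_lattice p - int_lattice"
    and diff: "\<And>\<xi> \<eta>. \<xi> \<in> \<Lambda> \<Longrightarrow> \<eta> \<in> \<Lambda> \<Longrightarrow> \<xi> \<noteq> \<eta> \<Longrightarrow> \<xi> - \<eta> \<in> frac_lattice p - int_lattice"
    and avoid: "\<And>\<xi> \<eta>. \<xi> \<in> \<Lambda> \<Longrightarrow> \<eta> \<in> \<Lambda> \<Longrightarrow> \<xi> - \<eta> - b \<notin> int_lattice"
    and k: "k = 2 \<or> k = 3 \<and> p = 3"
  shows "finite \<Lambda> \<and> k * card \<Lambda> \<le> p ^ 2"
proof -
  define f where "f = (\<lambda>(\<xi> :: real ^ 2, i :: nat). \<xi> + real i *\<^sub>R b)"
  have frac: "f u - f v \<in> frac_lattice p" if "u \<in> \<Lambda> \<times> {..<k}" "v \<in> \<Lambda> \<times> {..<k}" for u v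
  proof -
    obtain \<xi> i \<eta> j where uv: "u = (\<xi>, i)" "v = (\<eta>, j)" "\<xi> \<in> \<Lambda>" "\<eta> \<in> \<Lambda>" using \<open>u \<in> _\<close> \<open>v \<in> _\<close> by auto
    have "\<xi> - \<eta> \<in> frac_lattice p" (is ?diff)
      using diff[of \<xi> \<eta>] uv by (cases "\<xi> = \<eta>") (auto intro: int_lattice_imp_frac_lattice)
    have "(\<xi> - \<eta>) + (real i *\<^sub>R b - real j *\<^sub>R b) \<in> frac_lattice p"
      using b by (intro frac_lattice_add[OF \<open>?diff\<close>] frac_lattice_diff frac_lattice_scaleR_nat) auto
    then show ?thesis by (simp add: uv f_def algebra_simps)
  qed
  have less: "f (\<xi>, i) - f (\<eta>, j) \<notin> int_lattice"
    if "\<xi> \<in> \<Lambda>" "\<eta> \<in> \<Lambda>" "i < j" "j < k" for \<xi> \<eta> i j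
  proof -
    consider "j = i + 1" | "i = 0" "j = 2" "p = 3"
      using \<open>i < j\<close> \<open>j < k\<close> k by force
    then show ?thesis
    proof cases
      case 1
      then have "f (\<xi>, i) - f (\<eta>, j) = \<xi> - \<eta> - b" by (simp add: f_def algebra_simps)
      then show ?thesis using avoid that by simp
    next
      case 2
      \<comment> \<open>Since \<open>3 b\<close> is integral, \<open>- 2 b\<close> is congruent to
        \<open>b\<close>, and the claim reduces to the avoidance hypothesis with
        \<open>\<xi>\<close> and \<open>\<eta>\<close> exchanged.\<close>
      have "f (\<xi>, i) - f (\<eta>, j) + (\<eta> - \<xi> - b) = - (real p *\<^sub>R b)"
        by (simp add: f_def 2 vec_eq_iff algebra_simps)
      moreover have "real p *\<^sub>R b \<in> int_lattice" using b by (simp add: frac_lattice_def)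
      ultimately show ?thesis
        using avoid[OF that(2,1)] int_lattice_diff int_lattice_uminus_iff
        by (metis add_diff_cancel_left')
    qed
  qed
  have "f u - f v \<notin> int_lattice" if "u \<in> \<Lambda> \<times> {..<k}" "v \<in> \<Lambda> \<times> {..<k}" "u \<noteq> v" for u v
  proof -
    obtain \<xi> i \<eta> j where uv: "u = (\<xi>, i)" "v = (\<eta>, j)" "\<xi> \<in> \<Lambda>" "\<eta> \<in> \<Lambda>" "i < k" "j < k"
      using \<open>u \<in> _\<close> \<open>v \<in> _\<close> by auto
    consider "i < j" | "j < i" | "i = j" by linarith
    then show ?thesis
    proof cases
      case 3
      then show ?thesis using diff[of \<xi> \<eta>] uv \<open>u \<noteq> v\<close> by (simp add: f_def)
    qed (use less uv int_lattice_minus_commute in metis)+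
  qed
  with frac have "finite (\<Lambda> \<times> {..<k}) \<and> card (\<Lambda> \<times> {..<k}) \<le> p ^ 2"
    by (intro card_incongruent_family_le[OF p, of _ f]) auto
  \<comment> \<open>A nonempty second factor lets finiteness pass from the product to
    \<open>\<Lambda>\<close>.\<close>
  moreover have "{..<k} \<noteq> {}" using k by (auto simp: lessThan_empty_iff)
  ultimately show ?thesis
    using finite_cartesian_productD1 by (auto simp: card_cartesian_product mult.commute)
qed

subsection \<open>Orbits on the fractional lattice\<close>

text \<open>The last two assumptions say that \<open>L\<close> acts on the torus and is injective on
  the finite group of \<open>p\<close>-torsion points, hence permutes it. Everything about orbits
  below follows from this.\<close>

locale lattice_automorphism =
  fixes p :: nat and L :: "real ^ 2 \<Rightarrow> real ^ 2"
  assumes p_pos: "p > 0" and linear: "linear L"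
    and int_lattice_image: "x \<in> int_lattice \<Longrightarrow> L x \<in> int_lattice"
    and int_lattice_cancel: "x \<in> frac_lattice p \<Longrightarrow> L x \<in> int_lattice \<Longrightarrow> x \<in> int_lattice"
begin

lemma pow_diff: "(L ^^ n) (x - y) = (L ^^ n) x - (L ^^ n) y"
  by (induction n) (simp_all add: linear_diff[OF linear])

lemma pow_add: "(L ^^ (m + n)) x = (L ^^ m) ((L ^^ n) x)"
  by (simp add: funpow_add)

lemma pow_int_lattice: "x \<in> int_lattice \<Longrightarrow> (L ^^ n) x \<in> int_lattice"
  by (induction n) (simp_all add: int_lattice_image)

lemma pow_cong: "x - y \<in> int_lattice \<Longrightarrow> (L ^^ n) x - (L ^^ n) y \<in> int_lattice"
  using pow_int_lattice[of "x - y" n] by (simp add: pow_diff)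

lemma pow_frac_lattice: "x \<in> frac_lattice p \<Longrightarrow> (L ^^ n) x \<in> frac_lattice p"
proof (induction n)
  case (Suc n)
  then show ?case
    using int_lattice_image[of "real p *\<^sub>R (L ^^ n) x"]
    by (simp add: frac_lattice_def linear_scale[OF linear])
qed simp

lemma pow_int_lattice_cancel:
  "x \<in> frac_lattice p \<Longrightarrow> (L ^^ n) x \<in> int_lattice \<Longrightarrow> x \<in> int_lattice"
proof (induction n)
  case (Suc n)
  then show ?case using int_lattice_cancel[OF pow_frac_lattice[of x n]] by simp
qed simp

lemma pow_frac_lattice_diff:
  "x \<in> frac_lattice p - int_lattice \<Longrightarrow> (L ^^ n) x \<in> frac_lattice p - int_lattice"
  using pow_frac_lattice pow_int_lattice_cancel by blast

text \<open>Pigeonhole: the \<open>p ^ 2\<close> iterates with exponents from 0 to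
  \<open>p ^ 2 - 1\<close> fall into only \<open>p ^ 2 - 1\<close> nonzero classes. Cancelling the
  smaller power in a collision makes the orbit purely periodic.\<close>

lemma exists_period:
  assumes z: "z \<in> frac_lattice p - int_lattice"
  obtains t where "1 \<le> t" "t \<le> p ^ 2 - 1" "(L ^^ t) z - z \<in> int_lattice"
proof -
  define g where "g n = frac_vec ((L ^^ n) z)" for n
  have "g n \<in> grid p - {0}" for n
  proof -
    have "(L ^^ n) z \<in> frac_lattice p - int_lattice" by (rule pow_frac_lattice_diff[OF z])
    then show ?thesis
      using frac_vec_in_grid[OF p_pos] frac_vec_cong[of "(L ^^ n) z"] by (auto simp: g_def)
  qed
  then have "g ` {0..p ^ 2 - 1} \<subseteq> grid p - {0}" by (rule image_subsetI)
  moreover have "0 \<in> grid p" using p_pos by (simp add: grid_eq frac_lattice_def)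
  ultimately have "card (g ` {0..p ^ 2 - 1}) \<le> p ^ 2 - 1"
    using card_mono[of "grid p - {0}"] card_grid[OF p_pos] by simp
  moreover have "p ^ 2 - 1 < card {0..p ^ 2 - 1}" by simp
  ultimately have "\<not> inj_on g {0..p ^ 2 - 1}" by (intro pigeonhole) linarith
  then obtain m n where mn: "m < n" "n \<le> p ^ 2 - 1" "g m = g n"
    unfolding inj_on_def by (metis atLeastAtMost_iff linorder_neqE_nat)
  have "(L ^^ n) z - (L ^^ m) z \<in> int_lattice"
    using frac_vec_eq_imp mn(3) unfolding g_def by metis
  then have "(L ^^ m) ((L ^^ (n - m)) z - z) \<in> int_lattice"
    using mn(1) by (simp add: pow_diff flip: pow_add)
  then have "(L ^^ (n - m)) z - z \<in> int_lattice"
    using z pow_frac_lattice by (blast intro: pow_int_lattice_cancel)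
  with mn(1,2) show thesis by (intro that[of "n - m"]) auto
qed

lemma period_mult:
  assumes "(L ^^ t) z - z \<in> int_lattice"
  shows "(L ^^ (t * n)) z - z \<in> int_lattice"
proof (induction n)
  case (Suc n)
  have "(L ^^ t) ((L ^^ (t * n)) z) - (L ^^ t) z + ((L ^^ t) z - z) \<in> int_lattice"
    using pow_cong[OF Suc] assms by (rule int_lattice_add)
  then show ?case by (simp add: pow_add)
qed simp

text \<open>Zeros of the transform allow every \<open>j \<ge> 1\<close>, while
  \<open>zero_orbit\<close> stops at \<open>p ^ 2 - 1\<close>; periodicity bridges the gap.\<close>

lemma reduce_exponent:
  assumes z: "z \<in> frac_lattice p - int_lattice" and "j \<ge> 1"
  obtains j' where "j' \<in> {1..p ^ 2 - 1}" "(L ^^ j) z - (L ^^ j') z \<in> int_lattice"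
proof -
  obtain t where t: "1 \<le> t" "t \<le> p ^ 2 - 1" "(L ^^ t) z - z \<in> int_lattice"
    using exists_period[OF z] .
  show thesis
  proof (cases "j mod t = 0")
    \<comment> \<open>The remainder 0 is not an admissible exponent, so the period \<open>t\<close>
      itself replaces it.\<close>
    case True
    then have "(L ^^ j) z - z \<in> int_lattice"
      using period_mult[OF t(3), of "j div t"] by fastforce
    from int_lattice_diff[OF this t(3)] show thesis
      using t by (intro that[of t]) auto
  next
    case False
    have "(L ^^ j) z - (L ^^ (j mod t)) z \<in> int_lattice"
      using pow_cong[OF period_mult[OF t(3), of "j div t"], of "j mod t"]
      by (simp flip: pow_add)
    moreover have "j mod t < t" using t(1) by simp
    ultimately show thesis using t(2) False by (intro that[of "j mod t"]) auto
  qed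
qed

text \<open>Another \<open>(t - 1) * j\<close> steps complete \<open>L ^^ j\<close> to a multiple of
  the period \<open>t\<close>. The bound on \<open>i\<close> is uniform in \<open>z\<close> and
  \<open>j\<close>, so one fixed power of \<open>L\<close> can later serve all grid points.\<close>

lemma return_exponent:
  assumes z: "z \<in> frac_lattice p - int_lattice" and "j \<le> p ^ 2"
  obtains i where "i \<le> p ^ 4" "(L ^^ i) ((L ^^ j) z) - z \<in> int_lattice"
proof -
  obtain t where t: "1 \<le> t" "t \<le> p ^ 2 - 1" "(L ^^ t) z - z \<in> int_lattice"
    using exists_period[OF z] .
  have "(t - 1) * j \<le> p ^ 2 * p ^ 2" using t(2) assms(2) by (intro mult_le_mono) auto
  moreover have "(t - 1) * j + j = t * j" using t(1) by (cases t) auto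
  ultimately show thesis
    using period_mult[OF t(3), of j]
    by (intro that[of "(t - 1) * j"]) (simp_all flip: pow_add power_add)
qed

end

text \<open>For cancellation, the adjugate matrix shows that \<open>det M\<close> times
  \<open>x\<close> is integral, and \<open>p\<close> times \<open>x\<close> is integral as well; a
  Bezout combination of the two gives \<open>x\<close>.\<close>

lemma transpose_lattice_automorphism:
  fixes M :: "int ^ 2 ^ 2"
  assumes "p > 0" "gcd (det M) (int p) = 1"
  shows "lattice_automorphism p (\<lambda>x. transpose (real_matrix M) *v x)"
proof (rule lattice_automorphism.intro)
  let ?L = "\<lambda>x. transpose (real_matrix M) *v x"
  have L: "?L x $ i = of_int (M $ 1 $ i) * x $ 1 + of_int (M $ 2 $ i) * x $ 2" for x i
    by (simp add: matrix_vector_mult_def transpose_def sum_2 del: transpose_matrix_vector)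
  show "linear ?L" by (rule matrix_vector_mul_linear)
  show "?L x \<in> int_lattice" if "x \<in> int_lattice" for x
    using that by (simp add: int_lattice_def L del: transpose_matrix_vector)
  show "x \<in> int_lattice" if x: "x \<in> frac_lattice p" "?L x \<in> int_lattice" for x
  proof -
    obtain u v where uv: "u * det M + v * int p = 1"
      using bezout_int[of "det M" "int p"] assms(2) by auto
    have Lx: "?L x $ 1 \<in> \<int>" "?L x $ 2 \<in> \<int>" using x(2) by (simp_all add: int_lattice_def)
    have "of_int (det M) * x $ 1 = of_int (M $ 2 $ 2) * ?L x $ 1 - of_int (M $ 2 $ 1) * ?L x $ 2"
      "of_int (det M) * x $ 2 = of_int (M $ 1 $ 1) * ?L x $ 2 - of_int (M $ 1 $ 2) * ?L x $ 1"
      unfolding L by (simp_all add: det_2 algebra_simps)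
    then have "of_int (det M) * x $ 1 \<in> \<int>" "of_int (det M) * x $ 2 \<in> \<int>"
      using Lx by (metis Ints_diff Ints_mult Ints_of_int)+
    then have det_x: "of_int (det M) * x $ i \<in> \<int>" for i by (metis exhaust_2)
    have p_x: "real p * x $ i \<in> \<int>" for i
      using x(1) by (simp add: frac_lattice_def int_lattice_def)
    have "of_int u * (of_int (det M) * x $ i) + of_int v * (real p * x $ i) \<in> \<int>" for i
      by (intro Ints_add[OF Ints_mult Ints_mult] Ints_of_int det_x p_x)
    moreover have "of_int u * (of_int (det M) * x $ i) + of_int v * (real p * x $ i) = x $ i" for i
    proof -
      have "real_of_int (u * det M + v * int p) * x $ i = x $ i" unfolding uv by simp
      then show ?thesis by (simp add: algebra_simps)
    qed
    ultimately show ?thesis by (simp add: int_lattice_def)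
  qed
qed (use assms in simp)

subsection \<open>Counting orthogonal exponentials\<close>

text \<open>The assumption only covers zeros in the unit square. With integer digits the mask is
  periodic, which carries it over to all zeros.\<close>

lemma mask_zero_in_frac_lattice:
  assumes p: "p > 0" and D: "D \<subseteq> int_lattice" "mask_zeros D \<subseteq> punctured_grid p"
    and z: "mask D z = 0"
  shows "frac_vec z \<in> mask_zeros D" "z \<in> frac_lattice p - int_lattice"
proof -
  have "mask D (frac_vec z) = 0" using z mask_lattice_eq[OF D(1) frac_vec_cong] by simp
  then show fz: "frac_vec z \<in> mask_zeros D" using frac_vec_bounds by (simp add: mask_zeros_def)
  then have *: "frac_vec z \<in> grid p" "frac_vec z \<noteq> 0"
    using D(2) by (auto simp: punctured_grid_def)
  have "frac_vec z + (z - frac_vec z) \<in> frac_lattice p"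
    using *(1) p int_lattice_imp_frac_lattice[OF frac_vec_cong]
    by (intro frac_lattice_add) (auto simp: grid_eq)
  moreover have "z \<notin> int_lattice"
  proof
    assume "z \<in> int_lattice"
    then have "z - (z - frac_vec z) \<in> int_lattice" using frac_vec_cong by (rule int_lattice_diff)
    then show False using grid_inter_int_lattice[OF p *(1)] *(2) by simp
  qed
  ultimately show "z \<in> frac_lattice p - int_lattice" by simp
qed

lemma mod_lattice_quotient_mem_iff:
  "mod_lattice `` {b} \<in> X // mod_lattice \<longleftrightarrow> (\<exists>y\<in>X. b - y \<in> int_lattice)"
  by (auto simp: quotient_def mod_lattice_class_eq_iff)

theorem theorem1p3:
  fixes p :: nat and D :: "(real ^ 2) set" and M :: "int ^ 2 ^ 2" and \<mu> :: "(real ^ 2) measure"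
  assumes "p \<ge> 2"
    and "finite D" and "D \<subseteq> int_lattice"
    and "mask_zeros D \<noteq> {}" and "mask_zeros D \<subseteq> punctured_grid p"
    and "expanding (real_matrix M)" and "gcd (det M) (int p) = 1"
    and "is_self_affine_measure (real_matrix M) D \<mu>"
  shows "(M \<in> matrix_class1 p D \<longrightarrow> n_star \<mu> \<le> enat (P_tilde p)) \<and>
         (M \<in> matrix_class2 p D \<longrightarrow> n_star \<mu> = enat (p ^ 2))"
proof -
  define L where "L = (\<lambda>x. transpose (real_matrix M) *v x)"
  define F where "F = frac_lattice p - int_lattice"
  have p: "p > 0" using assms(1) by simp
  interpret lattice_automorphism p L
    unfolding L_def by (rule transpose_lattice_automorphism[OF p assms(7)])
  \<comment> \<open>The mask of an empty digit set is identically 0, which would make the origin a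
    mask zero.\<close>
  have "D \<noteq> {}"
  proof
    assume "D = {}"
    then have "0 \<in> mask_zeros D" by (simp add: mask_zeros_def mask_def)
    then show False using assms(5) by (auto simp: punctured_grid_def)
  qed
  then have fourier: "fourier \<mu> \<xi> = 0 \<longleftrightarrow> (\<exists>j\<ge>1. \<exists>z. mask D z = 0 \<and> \<xi> = (L ^^ j) z)" for \<xi>
    unfolding L_def by (rule fourier_eq_0_iff[OF assms(6,8,2)])
  note zero = mask_zero_in_frac_lattice[OF p assms(3,5)]
  have orth: "\<xi> - \<eta> \<in> F"
    if *: "orthogonal_exponentials \<mu> \<Lambda>" "\<xi> \<in> \<Lambda>" "\<eta> \<in> \<Lambda>" "\<xi> \<noteq> \<eta>" for \<Lambda> \<xi> \<eta>
  proof -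
    obtain j z where "mask D z = 0" "\<xi> - \<eta> = (L ^^ j) z"
      using * unfolding orthogonal_exponentials_iff fourier by blast
    then show ?thesis using zero(2) pow_frac_lattice_diff by (simp add: F_def)
  qed
  have orbit: "y \<in> zero_orbit p D M \<longleftrightarrow>
      (\<exists>j\<in>{1..p ^ 2 - 1}. \<exists>z\<in>mask_zeros D. y = (L ^^ j) z)" for y
    unfolding zero_orbit_def L_def by auto
  have zeros: "mask D z = 0" "z \<in> F" if "z \<in> mask_zeros D" for z
    using that zero(2)[of z] by (auto simp: mask_zeros_def F_def)
  have grid_F: "b \<in> F" if "b \<in> punctured_grid p" for b
    using that grid_inter_int_lattice[OF p, of b] grid_eq[OF p]
    by (auto simp: punctured_grid_def F_def)
  have case1: "n_star \<mu> \<le> enat (P_tilde p)" if M: "M \<in> matrix_class1 p D"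
  proof -
    have "zero_orbit p D M // mod_lattice \<subset> punctured_grid p // mod_lattice"
      using M by (simp add: matrix_class1_def)
    then obtain X where X: "X \<in> punctured_grid p // mod_lattice" "X \<notin> zero_orbit p D M // mod_lattice"
      by blast
    from X(1) obtain b where "b \<in> punctured_grid p" "X = mod_lattice `` {b}" by (rule quotientE)
    with X(2) have b: "b \<in> punctured_grid p"
      "mod_lattice `` {b} \<notin> zero_orbit p D M // mod_lattice" by simp_all
    \<comment> \<open>Otherwise \<open>b\<close> would be congruent to \<open>(L ^^ j) z\<close> for
      a mask zero \<open>z\<close>. Passing to the representative of \<open>z\<close> and to a
      reduced exponent changes this point only by lattice vectors, so the class of \<open>b\<close>
      would lie in the orbit.\<close>
    have avoid: "\<xi> - \<eta> - b \<notin> int_lattice"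
      if \<Lambda>: "orthogonal_exponentials \<mu> \<Lambda>" "\<xi> \<in> \<Lambda>" "\<eta> \<in> \<Lambda>" for \<Lambda> \<xi> \<eta>
    proof
      assume *: "\<xi> - \<eta> - b \<in> int_lattice"
      have "\<xi> \<noteq> \<eta>" using * grid_F[OF b(1)] by (auto simp: F_def)
      then obtain j z where z: "j \<ge> 1" "mask D z = 0" "\<xi> - \<eta> = (L ^^ j) z"
        using \<Lambda> unfolding orthogonal_exponentials_iff fourier by blast
      note fz = zero(1)[OF z(2)]
      have "frac_vec z \<in> frac_lattice p - int_lattice" using zeros(2)[OF fz] by (simp add: F_def)
      from reduce_exponent[OF this z(1)] obtain j' where j': "j' \<in> {1..p ^ 2 - 1}"
        "(L ^^ j) (frac_vec z) - (L ^^ j') (frac_vec z) \<in> int_lattice" .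
      have "(L ^^ j) z - (L ^^ j) (frac_vec z) \<in> int_lattice" by (rule pow_cong[OF frac_vec_cong])
      from int_lattice_add[OF this j'(2)] have "\<xi> - \<eta> - (L ^^ j') (frac_vec z) \<in> int_lattice"
        by (simp add: z(3))
      from int_lattice_diff[OF this *] have "b - (L ^^ j') (frac_vec z) \<in> int_lattice"
        by simp
      moreover have "(L ^^ j') (frac_vec z) \<in> zero_orbit p D M" using j'(1) fz orbit by blast
      ultimately show False using b(2) unfolding mod_lattice_quotient_mem_iff by blast
    qed
    show ?thesis unfolding n_star_def
    proof (rule SUP_least)
      fix \<Lambda> assume "\<Lambda> \<in> {\<Lambda>. maximal_orthogonal_exponentials \<mu> \<Lambda>}"
      then have \<Lambda>: "orthogonal_exponentials \<mu> \<Lambda>" by (simp add: maximal_orthogonal_exponentials_def)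
      have bound: "finite \<Lambda> \<and> k * card \<Lambda> \<le> p ^ 2" if "k = 2 \<or> k = 3 \<and> p = 3" for k
        using grid_F[OF b(1)] orth[OF \<Lambda>] avoid[OF \<Lambda>] that
        unfolding F_def by (intro card_avoiding_le[OF p]) auto
      have "card \<Lambda> \<le> P_tilde p"
      proof -
        \<comment> \<open>For odd \<open>p\<close> the square is odd, so the bound with
          \<open>k = 2\<close> improves to half of \<open>p ^ 2 - 1\<close>. For
          \<open>p = 3\<close> this would give only 4, and \<open>k = 3\<close> yields the required
          3.\<close>
        have "c \<le> (q - 1) div 2" if "odd q" "2 * c \<le> q" for c q :: nat
          using that by presburger
        then show ?thesis
          using bound[of 2] bound[of 3] by (auto simp: P_tilde_def)
      qed
      then show "ext_card \<Lambda> \<le> enat (P_tilde p)" using bound[of 2] by (simp add: ext_card_def)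
    qed
  qed
  have upper: "finite \<Lambda> \<and> card \<Lambda> \<le> p ^ 2" if "orthogonal_exponentials \<mu> \<Lambda>" for \<Lambda>
    using orth[OF that] unfolding F_def by (intro card_incongruent_family_le[OF p, of _ id]) auto
  have case2: "n_star \<mu> = enat (p ^ 2)" if M: "M \<in> matrix_class2 p D"
  proof (rule antisym)
    show "n_star \<mu> \<le> enat (p ^ 2)"
      unfolding n_star_def maximal_orthogonal_exponentials_def
      using upper by (intro SUP_least) (auto simp: ext_card_def)
    \<comment> \<open>Incongruence of the differences is not enough: a zero of the Fourier transform must be an
      exact image \<open>L ^^ j\<close> of a mask zero. Applying a high power of \<open>L\<close> to the grid leaves room
      for the exponent.\<close>
    define N where "N = p ^ 4 + 1"
    define \<Lambda> where "\<Lambda> = (L ^^ N) ` grid p"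
    have zero_pow: "fourier \<mu> ((L ^^ N) x) = 0" if x: "x \<in> F" for x
    proof -
      have "frac_vec x \<in> grid p" "frac_vec x \<noteq> 0"
        using x frac_vec_in_grid[OF p] frac_vec_cong[of x] by (auto simp: F_def)
      then have "mod_lattice `` {frac_vec x} \<in> punctured_grid p // mod_lattice"
        by (auto simp: punctured_grid_def intro: quotientI)
      then have "mod_lattice `` {frac_vec x} \<in> zero_orbit p D M // mod_lattice"
        using M by (simp add: matrix_class2_def)
      then obtain y where y: "y \<in> zero_orbit p D M" "frac_vec x - y \<in> int_lattice"
        unfolding mod_lattice_quotient_mem_iff by (elim bexE)
      from y(1) obtain j z where jz: "j \<in> {1..p ^ 2 - 1}" "z \<in> mask_zeros D" "y = (L ^^ j) z"
        unfolding orbit by (elim bexE)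
      note z = jz(1,2) y(2)[unfolded jz(3)]
      have "z \<in> frac_lattice p - int_lattice" using zeros(2)[OF z(2)] by (simp add: F_def)
      moreover have "j \<le> p ^ 2" using z(1) by auto
      \<comment> \<open>As \<open>x\<close> is congruent to \<open>(L ^^ j) z\<close>, the power
        \<open>L ^^ i\<close> takes it to a point congruent to \<open>z\<close>, which is an exact
        mask zero by periodicity of the mask.\<close>
      ultimately obtain i where i: "i \<le> p ^ 4" "(L ^^ i) ((L ^^ j) z) - z \<in> int_lattice"
        using return_exponent by blast
      have "x - (L ^^ j) z \<in> int_lattice"
        using int_lattice_add[OF frac_vec_cong[of x] z(3)] by simp
      from int_lattice_add[OF pow_cong[OF this, of i] i(2)] have "(L ^^ i) x - z \<in> int_lattice"
        by simp
      then have "mask D ((L ^^ i) x) = 0"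
        using mask_lattice_eq[OF assms(3)] zeros(1)[OF z(2)] by metis
      \<comment> \<open>The extra 1 in \<open>N\<close> keeps the remaining exponent positive, as a
        zero of the transform requires.\<close>
      moreover have "(L ^^ N) x = (L ^^ (N - i)) ((L ^^ i) x)" "N - i \<ge> 1"
        using i(1) by (simp_all add: N_def flip: pow_add)
      ultimately show ?thesis unfolding fourier by blast
    qed
    have F_diff: "x - y \<in> F" if "x \<in> grid p" "y \<in> grid p" "x \<noteq> y" for x y
    proof -
      have "x - y \<notin> int_lattice"
      proof
        assume *: "x - y \<in> int_lattice"
        have "x $ i = y $ i" for i
          using * that frac_unique_iff[of "x $ i" "y $ i"] frac_eq[of "x $ i"]
          by (simp add: grid_eq[OF p] int_lattice_def)
        with \<open>x \<noteq> y\<close> show False by (simp add: vec_eq_iff)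
      qed
      then show ?thesis using that by (auto simp: F_def grid_eq[OF p])
    qed
    have inj: "inj_on (L ^^ N) (grid p)"
    proof (rule inj_onI, rule ccontr)
      fix x y assume xy: "x \<in> grid p" "y \<in> grid p" "(L ^^ N) x = (L ^^ N) y" "x \<noteq> y"
      then have "(L ^^ N) (x - y) \<in> int_lattice" by (simp add: pow_diff)
      then show False using F_diff[OF xy(1,2,4)] pow_frac_lattice_diff unfolding F_def by blast
    qed
    have \<Lambda>: "finite \<Lambda>" "card \<Lambda> = p ^ 2"
      unfolding \<Lambda>_def using card_grid[OF p] card_image[OF inj] by auto
    have orth_\<Lambda>: "orthogonal_exponentials \<mu> \<Lambda>"
      unfolding orthogonal_exponentials_iff \<Lambda>_def using zero_pow F_diff
      by (auto simp flip: pow_diff)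
    \<comment> \<open>Maximality comes from counting: \<open>\<Lambda>\<close> already attains the
      bound \<open>upper\<close>.\<close>
    have "\<Lambda>' = \<Lambda>" if "orthogonal_exponentials \<mu> \<Lambda>'" "\<Lambda> \<subseteq> \<Lambda>'" for \<Lambda>'
      using card_seteq[of \<Lambda>' \<Lambda>] upper[OF that(1)] \<Lambda> that(2) by auto
    then have "maximal_orthogonal_exponentials \<mu> \<Lambda>"
      using \<Lambda>(1) orth_\<Lambda> by (simp add: maximal_orthogonal_exponentials_def countable_finite)
    then have "ext_card \<Lambda> \<le> n_star \<mu>"
      unfolding n_star_def by (intro SUP_upper) simp
    then show "enat (p ^ 2) \<le> n_star \<mu>" using \<Lambda> by (simp add: ext_card_def)
  qed
  show ?thesis using case1 case2 by blast
qed

end
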